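(* Let $X$ be a finite dimensional real Banach space and $Y$ a subspace of $X$. Then $(Y, CB(X))$ has property-$(lP_2)$ if and only if $(Y, \mathcal{F})$ has property-$(P_2)$, where $\mathcal{F}=\{F \in CB(X): rad_Y(F)=1\}$.
   Context: $CL(X)$ and $CB(X)$ denote the sets of non-empty closed, respectively non-empty closed bounded, subsets of $X$; $B_X$ is the closed unit ball. For $x\in X$ and $F\in CB(X)$, $r(x,F)=\sup\{\|x-a\|: a\in F\}$. For $V\in CL(X)$, $rad_V(F)=\inf\{r(v,F): v\in V\}$, $Z_V(F)=\{v\in V: r(v,F)=rad_V(F)\}$, and for $\delta\ge 0$, $Z_V(F,\delta)=\{v\in V: r(v,F)\le rad_V(F)+\delta\}$. $\mathcal{H}$ is the Hausdorff metric on $CB(X)$: $\mathcal{H}(A,B)=\inf\{r>0: A\subseteq B+rB_X,\ B\subseteq A+rB_X\}$. For $V\in CL(X)$ and $\mathcal{F}\subseteq CB(X)$: - $(V,\mathcal{F})$ has property-$(P_2)$ if $Z_V(G)\ne\emptyset$ for every $G\in\mathcal{F}$ and for every $\epsilon>0$ there exists $\delta>0$ such that $Z_V(G,\delta)\subseteq Z_V(G)+\epsilon B_X$ for every $G\in\mathcal{F}$. - $(V,\mathcal{F})$ has property-$(lP_2)$ if $Z_V(G)\neq\emptyset$ for every $G\in\mathcal{F}$, and for every $\epsilon>0$ and $F\in\mathcal{F}$ there exists $\delta>0$ such that $Z_V(G,\delta)\subseteq Z_V(G)+\epsilon B_X$ whenever $G\in\mathcal{F}$ and $\mathcal{H}(F,G)<\delta$.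 *)

theory Defs
  imports "HOL-Analysis.Analysis"
begin

definition CB :: "'a::real_normed_vector set set" where
  "CB = {F. F \<noteq> {} \<and> closed F \<and> bounded F}"

(* Every Sup and Inf below is a real one; it is the intended quantity for F, A, B in CB
   and nonempty V: the sets involved are then nonempty and bounded on the relevant side. *)

definition far_dist :: "'a::real_normed_vector \<Rightarrow> 'a set \<Rightarrow> real" where
  "far_dist x F = (SUP a\<in>F. norm (x - a))"

definition rad :: "'a::real_normed_vector set \<Rightarrow> 'a set \<Rightarrow> real" where
  "rad V F = (INF v\<in>V. far_dist v F)"

definition centers :: "'a::real_normed_vector set \<Rightarrow> 'a set \<Rightarrow> 'a set" where
  "centers V F = {v \<in> V. far_dist v F = rad V F}"

definition near_centers :: "'a::real_normed_vector set \<Rightarrow> 'a set \<Rightarrow> real \<Rightarrow> 'a set" where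
  "near_centers V F \<delta> = {v \<in> V. far_dist v F \<le> rad V F + \<delta>}"

(* A + r B_X, a Minkowski sum; "+" on sets is that of HOL-Library.Set_Algebras *)
definition enlarge :: "'a::real_normed_vector set \<Rightarrow> real \<Rightarrow> 'a set" where
  "enlarge A r = A + (\<lambda>x. r *\<^sub>R x) ` cball 0 1"

definition hausdorff_dist :: "'a::real_normed_vector set \<Rightarrow> 'a set \<Rightarrow> real" where
  "hausdorff_dist A B = Inf {r. r > 0 \<and> A \<subseteq> enlarge B r \<and> B \<subseteq> enlarge A r}"

(* Both properties are meant for nonempty closed V and families contained in CB. *)

definition property_P2 :: "'a::real_normed_vector set \<Rightarrow> 'a set set \<Rightarrow> bool" where
  "property_P2 V \<F> \<longleftrightarrow>
     (\<forall>G\<in>\<F>. centers V G \<noteq> {}) \<and>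
     (\<forall>\<epsilon>>0. \<exists>\<delta>>0. \<forall>G\<in>\<F>. near_centers V G \<delta> \<subseteq> enlarge (centers V G) \<epsilon>)"

definition property_lP2 :: "'a::real_normed_vector set \<Rightarrow> 'a set set \<Rightarrow> bool" where
  "property_lP2 V \<F> \<longleftrightarrow>
     (\<forall>G\<in>\<F>. centers V G \<noteq> {}) \<and>
     (\<forall>\<epsilon>>0. \<forall>F\<in>\<F>. \<exists>\<delta>>0. \<forall>G\<in>\<F>. hausdorff_dist F G < \<delta> \<longrightarrow>
        near_centers V G \<delta> \<subseteq> enlarge (centers V G) \<epsilon>)"

end

theory Submission
  imports Defs "HOL-Library.Diagonal_Subsequence"
begin

text \<open>A similarity \<open>x \<mapsto> t + c x\<close> with \<open>t \<in> Y\<close> and \<open>c > 0\<close> maps \<open>Y\<close> onto itself and scales radii,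
  (near-)centers and enlargements by \<open>c\<close>. Hence every set of radius 1 can be translated by a center
  into the unit ball, where bounded closed sets are sequentially compact for the Hausdorff distance;
  a sequence of counterexamples to \<open>(P\<^sub>2)\<close> would then accumulate at a set violating \<open>(lP\<^sub>2)\<close>.
  Conversely, the radius is 1-Lipschitz, so sets near \<open>F\<close> can be rescaled to radius 1 by factors that
  stay bounded if \<open>rad Y F > 0\<close>; if \<open>rad Y F = 0\<close>, all near-centers of a set near \<open>F\<close> are
  within a small distance of each other.\<close>

section \<open>Bounded closed sets in finite dimension\<close>

text \<open>A convergent sequence is bounded, so a single ball contains it, and the part of
  \<open>S\<close> in that ball is closed. In the next lemma this provides the closedness of a span
  from the induction hypothesis.\<close>

lemma closed_if_compact_cball:
  fixes S :: "'a::real_normed_vector set"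
  assumes "\<And>r. compact (cball 0 r \<inter> S)"
  shows "closed S"
  unfolding closed_sequential_limits
proof (intro allI impI, elim conjE)
  fix x l assume x: "\<forall>n. x n \<in> S" "x \<longlonglongrightarrow> l"
  obtain M where M: "\<And>n. norm (x n) \<le> M"
    using x(2) convergent_imp_Bseq[of x] by (auto simp: convergent_def Bseq_def)
  have "l \<in> cball 0 M \<inter> S"
  proof (rule closed_sequentially)
    show "closed (cball 0 M \<inter> S)" using assms by (rule compact_imp_closed)
    show "x n \<in> cball 0 M \<inter> S" for n using x M by simp
  qed (fact x(2))
  then show "l \<in> S" by simp
qed

text \<open>Induction on the generators. A new vector outside the closed set \<open>span B\<close>
  has positive distance \<open>d\<close> from it, which bounds its coefficient in every point of the
  ball; the bounded part of the larger span then comes from a continuous image of a compact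
  product.\<close>

lemma compact_cball_span:
  fixes B :: "'a::real_normed_vector set"
  assumes "finite B"
  shows "compact (cball 0 r \<inter> span B)"
  using assms
proof (induction B arbitrary: r rule: finite_induct)
  case empty
  then show ?case
    by (auto intro!: finite_imp_compact)
next
  case (insert b B)
  show ?case
  proof (cases "b \<in> span B")
    case True
    then show ?thesis using insert.IH by (simp add: span_redundant)
  next
    case False
    have b_notin: "b \<notin> closure (span B)"
      using False closed_if_compact_cball[OF insert.IH] by simp
    define d where "d = infdist b (span B)"
    have ne: "span B \<noteq> {}" using span_zero by blast
    have "d > 0"
      using b_notin ne infdist_nonneg[of b "span B"]
      by (auto simp: d_def in_closure_iff_infdist_zero less_le)
    \<comment> \<open>For t nonzero, dividing by t turns the claim into the fact that -s/t is a
      point of \<open>span B\<close>, hence at distance at least \<open>d\<close> from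
      \<open>b\<close>.\<close>
    have coeff: "\<bar>t\<bar> * d \<le> norm (s + t *\<^sub>R b)" if "s \<in> span B" for s t
    proof (cases "t = 0")
      case False
      have "- (inverse t *\<^sub>R s) \<in> span B"
        using that by (simp add: span_neg span_scale)
      then have "d \<le> dist b (- (inverse t *\<^sub>R s))"
        unfolding d_def by (rule infdist_le)
      also have "\<dots> = norm (inverse t *\<^sub>R (s + t *\<^sub>R b))"
        using False by (simp add: dist_norm algebra_simps)
      also have "\<dots> = norm (s + t *\<^sub>R b) / \<bar>t\<bar>"
        by (simp add: divide_inverse mult.commute)
      finally show ?thesis using False by (simp add: field_simps)
    qed auto
    \<comment> \<open>\<open>coeff\<close> bounds the coefficient of \<open>b\<close> for a point of
      the ball by \<open>T\<close>, and the triangle inequality bounds the remainder in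
      \<open>span B\<close> by \<open>R\<close>. \<open>K\<close> may leave the ball, so the two
      sets are compared after intersecting with it.\<close>
    define T where "T = r / d"
    define R where "R = r + T * norm b"
    define K where "K = (\<lambda>(s, t). s + t *\<^sub>R b) ` ((cball 0 R \<inter> span B) \<times> {-T..T})"
    have "compact K"
      unfolding K_def using insert.IH
      by (intro compact_continuous_image compact_Times)
        (auto simp: case_prod_unfold intro!: continuous_intros)
    have "cball 0 r \<inter> span (insert b B) = cball 0 r \<inter> K"
    proof (intro equalityI subsetI)
      fix x assume x: "x \<in> cball 0 r \<inter> span (insert b B)"
      then obtain t where t: "x - t *\<^sub>R b \<in> span B"
        by (auto simp: span_breakdown_eq)
      have "\<bar>t\<bar> * d \<le> norm x" using coeff[OF t, of t] by simp
      also have "\<dots> \<le> r" using x by simp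
      finally have tT: "\<bar>t\<bar> \<le> T" using \<open>d > 0\<close> by (simp add: T_def field_simps)
      have "norm (x - t *\<^sub>R b) \<le> norm x + \<bar>t\<bar> * norm b"
        using norm_triangle_ineq4[of x "t *\<^sub>R b"] by simp
      also have "\<dots> \<le> R"
        unfolding R_def using x tT by (intro add_mono mult_right_mono) auto
      finally have "(x - t *\<^sub>R b, t) \<in> (cball 0 R \<inter> span B) \<times> {-T..T}"
        using t tT by (auto simp: abs_le_iff)
      then have "x \<in> K" unfolding K_def by (rule rev_image_eqI) simp
      with x show "x \<in> cball 0 r \<inter> K" by blast
    next
      fix x assume "x \<in> cball 0 r \<inter> K"
      then show "x \<in> cball 0 r \<inter> span (insert b B)"
        by (auto simp: K_def span_breakdown_eq) (metis add_diff_cancel_right')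
    qed
    then show ?thesis using \<open>compact K\<close> by (simp add: closed_Int_compact)
  qed
qed

lemma closed_finite_dim_subspace:
  fixes B Y :: "'a::real_normed_vector set"
  assumes "finite B" "span B = UNIV" "subspace Y"
  shows "closed Y"
proof -
  obtain C where C: "C \<subseteq> Y" "independent C" "span C = Y"
    using \<open>subspace Y\<close> basis_exists[of Y] span_minimal by (metis subset_antisym)
  have "finite C"
    using independent_span_bound[OF assms(1), of C] C(2) assms(2) by simp
  then have "closed (span C)"
    by (intro closed_if_compact_cball compact_cball_span)
  then show ?thesis unfolding C(3) .
qed

section \<open>Selection theorem for subsets of a compact set\<close>

text \<open>The union over n of finite 1/(n+1)-nets is countable and dense.\<close>

lemma compact_countable_dense:
  fixes K :: "'a::metric_space set"
  assumes "compact K"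
  obtains D where "countable D" "D \<subseteq> K" "\<And>x e. x \<in> K \<Longrightarrow> e > 0 \<Longrightarrow> \<exists>p\<in>D. dist x p < e"
proof -
  have "\<exists>k. finite k \<and> k \<subseteq> K \<and> K \<subseteq> (\<Union>x\<in>k. ball x (inverse (real (Suc n))))" for n
  proof -
    have "K \<subseteq> (\<Union>x\<in>K. ball x (inverse (real (Suc n))))" by force
    then show ?thesis using compactE_image[OF assms, of K "\<lambda>x. ball x (inverse (real (Suc n)))"]
      by (metis open_ball)
  qed
  then obtain k where k: "\<And>n. finite (k n)" "\<And>n. k n \<subseteq> K"
    "\<And>n. K \<subseteq> (\<Union>x\<in>k n. ball x (inverse (real (Suc n))))"
    by metis
  show thesis
  proof (rule that[of "\<Union>n. k n"])
    show "countable (\<Union>n. k n)" using k(1) by (simp add: countable_finite)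
    show "(\<Union>n. k n) \<subseteq> K" using k(2) by blast
    fix x and e :: real assume x: "x \<in> K" and "e > 0"
    then obtain n where n: "inverse (real (Suc n)) < e" using reals_Archimedean by blast
    obtain p where "p \<in> k n" "dist p x < inverse (real (Suc n))"
      using k(3)[of n] x by auto
    with n show "\<exists>p\<in>\<Union>n. k n. dist x p < e"
      by (intro bexI[of _ p]) (auto simp: dist_commute)
  qed
qed

text \<open>Cantor's diagonal argument: at each point of an enumeration of \<open>S\<close>,
  Bolzano-Weierstrass refines the subsequence found so far.\<close>

lemma bounded_functions_convergent_subsequence:
  fixes f :: "nat \<Rightarrow> 'a \<Rightarrow> 'b::heine_borel"
  assumes "countable S" and bdd: "\<And>x. x \<in> S \<Longrightarrow> bounded (range (\<lambda>n. f n x))"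
  obtains k where "strict_mono (k::nat\<Rightarrow>nat)" "\<And>x. x \<in> S \<Longrightarrow> convergent (\<lambda>n. f (k n) x)"
proof (cases "S = {}")
  case True
  then show ?thesis using that[of id] by (simp add: strict_mono_id)
next
  case False
  with \<open>countable S\<close> obtain \<sigma> :: "nat \<Rightarrow> 'a" where \<sigma>: "S = range \<sigma>"
    using uncountable_def by blast
  interpret subseqs "\<lambda>i s. convergent (\<lambda>n. f (s n) (\<sigma> i))"
  proof
    fix i and s :: "nat \<Rightarrow> nat" assume "strict_mono s"
    have "bounded (range (\<lambda>n. f (s n) (\<sigma> i)))"
      by (rule bounded_subset[OF bdd[of "\<sigma> i"]]) (auto simp: \<sigma>)
    then show "\<exists>r. strict_mono r \<and> convergent (\<lambda>n. f ((s \<circ> r) n) (\<sigma> i))"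
      using bounded_imp_convergent_subsequence[of "\<lambda>n. f (s n) (\<sigma> i)"]
      by (auto simp: o_def convergent_def)
  qed
  have "convergent (\<lambda>n. f (diagseq n) (\<sigma> i))" for i
  proof -
    \<comment> \<open>Only the tail of the diagonal sequence from \<open>Suc i\<close> on is known
      to be a subsequence of a stage that settles \<open>\<sigma> i\<close>; dropping finitely many
      terms does not affect convergence.\<close>
    have "convergent (\<lambda>n. f ((diagseq \<circ> (+) (Suc i)) n) (\<sigma> i))"
    proof (rule diagseq_holds)
      fix r s n assume "strict_mono (r::nat\<Rightarrow>nat)" "convergent (\<lambda>m. f (s m) (\<sigma> n))"
      then show "convergent (\<lambda>m. f ((s \<circ> r) m) (\<sigma> n))"
        using convergent_subseq_convergent[of "\<lambda>m. f (s m) (\<sigma> n)" r] by (simp add: o_def)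
    qed
    then have "convergent (\<lambda>n. f (diagseq (n + Suc i)) (\<sigma> i))"
      by (simp add: o_def add.commute)
    then show ?thesis
      by (rule convergent_ignore_initial_segment[of "\<lambda>n. f (diagseq n) (\<sigma> i)", THEN iffD1])
  qed
  then show ?thesis using that[OF subseq_diagseq] \<sigma> by auto
qed

text \<open>Blaschke's selection theorem. The distance functions of the sets are 1-Lipschitz and so have
  a pointwise convergent subsequence; the limit set is where the limit of the distances vanishes.\<close>

theorem Blaschke_selection:
  fixes G :: "nat \<Rightarrow> 'a::metric_space set"
  assumes "compact K" and GK: "\<And>n. G n \<subseteq> K" and Gne: "\<And>n. G n \<noteq> {}"
  obtains F \<sigma> where "F \<subseteq> K" "F \<noteq> {}" "closed F" "strict_mono (\<sigma>::nat\<Rightarrow>nat)"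
    "\<And>e. e > 0 \<Longrightarrow> \<forall>\<^sub>F n in sequentially.
       (\<forall>x\<in>F. infdist x (G (\<sigma> n)) < e) \<and> (\<forall>x\<in>G (\<sigma> n). infdist x F < e)"
proof -
  obtain D where D: "countable D" "D \<subseteq> K" "\<And>x e. x \<in> K \<Longrightarrow> e > 0 \<Longrightarrow> \<exists>p\<in>D. dist x p < e"
    using compact_countable_dense[OF \<open>compact K\<close>] by blast
  have bdd: "bounded (range (\<lambda>n. infdist x (G n)))" if "x \<in> K" for x
  proof -
    have "\<bar>infdist x (G n)\<bar> \<le> diameter K" for n
    proof -
      obtain y where "y \<in> G n" using Gne by blast
      then have "infdist x (G n) \<le> dist x y" by (rule infdist_le)
      also have "\<dots> \<le> diameter K"
        using \<open>y \<in> G n\<close> GK that \<open>compact K\<close>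
        by (intro diameter_bounded_bound compact_imp_bounded) auto
      finally show ?thesis by (simp add: infdist_nonneg)
    qed
    then show ?thesis by (auto simp: bounded_iff)
  qed
  obtain \<sigma> where \<sigma>: "strict_mono (\<sigma>::nat\<Rightarrow>nat)"
    "\<And>p. p \<in> D \<Longrightarrow> convergent (\<lambda>n. infdist p (G (\<sigma> n)))"
    using bounded_functions_convergent_subsequence[OF D(1), of "\<lambda>n x. infdist x (G n)"] bdd D(2) by blast
  define h where "h n x = infdist x (G (\<sigma> n))" for n x
  have lip: "\<bar>h n x - h n y\<bar> \<le> dist x y" for n x y
    unfolding h_def by (rule infdist_triangle_abs)
  \<comment> \<open>Convergence on the dense set \<open>D\<close> spreads to all of \<open>K\<close>
    by an e/3 argument, because the functions \<open>h n\<close> share the Lipschitz constant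
    1.\<close>
  have conv: "convergent (\<lambda>n. h n x)" if x: "x \<in> K" for x
  proof (rule Cauchy_convergent, rule metric_CauchyI)
    fix e :: real assume "e > 0"
    then obtain p where p: "p \<in> D" "dist x p < e/3" using D(3)[OF x, of "e/3"] by auto
    have "Cauchy (\<lambda>n. h n p)" using \<sigma>(2)[OF p(1)] convergent_Cauchy by (simp add: h_def)
    then obtain N where N: "\<And>m n. m \<ge> N \<Longrightarrow> n \<ge> N \<Longrightarrow> dist (h m p) (h n p) < e/3"
      using \<open>e > 0\<close> by (metis Cauchy_def divide_pos_pos zero_less_numeral)
    show "\<exists>N. \<forall>m\<ge>N. \<forall>n\<ge>N. dist (h m x) (h n x) < e"
    proof (intro exI allI impI)
      fix m n assume "m \<ge> N" "n \<ge> N"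
      then have "\<bar>h m p - h n p\<bar> < e/3" using N by (simp add: dist_real_def)
      then show "dist (h m x) (h n x) < e"
        using lip[of m x p] lip[of n x p] p(2) unfolding dist_real_def by linarith
    qed
  qed
  define F where "F = {x \<in> K. (\<lambda>n. h n x) \<longlonglongrightarrow> 0}"
  \<comment> \<open>The whole sequence \<open>h n x\<close> is already known to converge, so a
    subsequence tending to 0 identifies its limit. This is how points are shown to lie in
    \<open>F\<close>.\<close>
  have cluster: "x \<in> F"
    if x: "x \<in> K" and s: "strict_mono (s::nat\<Rightarrow>nat)" and z: "z \<longlonglongrightarrow> x" and hz: "(\<lambda>n. h (s n) (z n)) \<longlonglongrightarrow> 0"
    for x s z
  proof -
    obtain l where l: "(\<lambda>n. h n x) \<longlonglongrightarrow> l" using conv[OF x] by (auto simp: convergent_def)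
    then have sub: "(\<lambda>n. h (s n) x) \<longlonglongrightarrow> l"
      using LIMSEQ_subseq_LIMSEQ[OF l s] by (simp add: o_def)
    have "(\<lambda>n. h (s n) (z n) + dist x (z n)) \<longlonglongrightarrow> 0 + dist x x"
      using z hz by (intro tendsto_intros)
    then have lim0: "(\<lambda>n. h (s n) (z n) + dist x (z n)) \<longlonglongrightarrow> 0" by simp
    have "(\<lambda>n. h (s n) x) \<longlonglongrightarrow> 0"
    proof (rule tendsto_sandwich[OF _ _ tendsto_const lim0])
      show "\<forall>\<^sub>F n in sequentially. 0 \<le> h (s n) x" by (simp add: h_def infdist_nonneg)
      show "\<forall>\<^sub>F n in sequentially. h (s n) x \<le> h (s n) (z n) + dist x (z n)"
        unfolding h_def by (simp add: infdist_triangle)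
    qed
    then have "l = 0" using sub LIMSEQ_unique by blast
    with l x show ?thesis by (simp add: F_def)
  qed
  have seqK: "\<exists>x\<in>K. \<exists>r. strict_mono (r::nat\<Rightarrow>nat) \<and> (z \<circ> r) \<longlonglongrightarrow> x" if "\<And>n. z n \<in> K" for z
    using \<open>compact K\<close> that unfolding compact_eq_seq_compact_metric seq_compact_def by blast
  \<comment> \<open>Points taken from the sets themselves have distance 0 to them, so their cluster
    points satisfy \<open>cluster\<close>. This gives both \<open>F\<close> nonempty and the second
    half of the approximation.\<close>
  have GF: "\<exists>x\<in>F. \<exists>r. strict_mono (r::nat\<Rightarrow>nat) \<and> (z \<circ> r) \<longlonglongrightarrow> x"
    if z: "\<And>n. z n \<in> G (\<sigma> (s n))" and s: "strict_mono (s::nat\<Rightarrow>nat)" for z s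
  proof -
    obtain x r where xr: "x \<in> K" "strict_mono (r::nat\<Rightarrow>nat)" "(z \<circ> r) \<longlonglongrightarrow> x"
      using seqK[of z] z GK by blast
    moreover have "h ((s \<circ> r) n) ((z \<circ> r) n) = 0" for n
      using z by (simp add: h_def)
    ultimately show ?thesis
      using cluster[of x "s \<circ> r" "z \<circ> r"] s strict_mono_o by auto
  qed
  have closedF: "closed F"
    unfolding closed_sequential_limits
  proof (intro allI impI, elim conjE)
    fix z x assume z: "\<forall>n. z n \<in> F" "z \<longlonglongrightarrow> x"
    have x: "x \<in> K"
      using z \<open>compact K\<close> compact_imp_closed closed_sequentially[of K z x] by (auto simp: F_def)
    have "(\<lambda>n. h n x) \<longlonglongrightarrow> 0"
    proof (rule metric_LIMSEQ_I)
      fix e :: real assume "e > 0"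
      then obtain m where m: "dist (z m) x < e/2"
        using z(2) by (metis half_gt_zero metric_LIMSEQ_D order_refl)
      have "(\<lambda>n. h n (z m)) \<longlonglongrightarrow> 0" using z(1) by (simp add: F_def)
      then obtain N where N: "\<And>n. n \<ge> N \<Longrightarrow> \<bar>h n (z m)\<bar> < e/2"
        using \<open>e > 0\<close> by (metis half_gt_zero metric_LIMSEQ_D dist_real_def diff_zero)
      show "\<exists>N. \<forall>n\<ge>N. dist (h n x) 0 < e"
      proof (intro exI allI impI)
        fix n assume "n \<ge> N"
        then show "dist (h n x) 0 < e"
          using N[of n] lip[of n x "z m"] m by (simp add: dist_real_def dist_commute abs_if split: if_splits)
      qed
    qed
    with x show "x \<in> F" by (simp add: F_def)
  qed
  have "\<forall>n. \<exists>y. y \<in> G (\<sigma> n)" using Gne by blast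
  then obtain z0 where "\<And>n. z0 n \<in> G (\<sigma> n)" by metis
  then have Fne: "F \<noteq> {}" using GF[of z0 id] by (auto simp: strict_mono_id)
  \<comment> \<open>Pointwise convergence to 0 on \<open>F\<close> becomes uniform by compactness:
    bad points of infinitely many indices would cluster at some x in \<open>F\<close>, and the
    Lipschitz bound would keep \<open>h\<close> away from 0 at x.\<close>
  have "\<forall>\<^sub>F n in sequentially. \<forall>x\<in>F. infdist x (G (\<sigma> n)) < e" if "e > 0" for e
  proof (rule ccontr)
    assume "\<not> ?thesis"
    then have "\<exists>\<^sub>F n in sequentially. \<exists>x\<in>F. e \<le> h n x"
      by (simp add: not_eventually h_def not_less)
    then obtain s where s: "strict_mono (s::nat\<Rightarrow>nat)" "\<And>n. \<exists>x\<in>F. e \<le> h (s n) x"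
      using infinite_enumerate[of "{n. \<exists>x\<in>F. e \<le> h n x}"]
      by (auto simp: INFM_iff_infinite cofinite_eq_sequentially[symmetric])
    then obtain z where z: "\<And>n. z n \<in> F" "\<And>n. e \<le> h (s n) (z n)" by metis
    obtain x r where xr: "x \<in> K" "strict_mono (r::nat\<Rightarrow>nat)" "(z \<circ> r) \<longlonglongrightarrow> x"
      using seqK[of z] z(1) by (auto simp: F_def)
    have "x \<in> F" using closedF xr(3) z(1) closed_sequentially[of F "z \<circ> r" x] by auto
    then have "(\<lambda>n. h n x) \<longlonglongrightarrow> 0" by (simp add: F_def)
    from LIMSEQ_subseq_LIMSEQ[OF this strict_mono_o[OF s(1) xr(2)]]
    have "(\<lambda>n. h (s (r n)) x + dist (z (r n)) x) \<longlonglongrightarrow> 0 + dist x x"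
      using xr(3) by (intro tendsto_intros) (simp_all add: o_def)
    moreover have "e \<le> h (s (r n)) x + dist (z (r n)) x" for n
      using z(2)[of "r n"] infdist_triangle[of "z (r n)" "G (\<sigma> (s (r n)))" x] by (simp add: h_def)
    ultimately have "e \<le> 0 + dist x x" by (intro LIMSEQ_le_const) auto
    with that show False by simp
  qed
  moreover have "\<forall>\<^sub>F n in sequentially. \<forall>x\<in>G (\<sigma> n). infdist x F < e" if "e > 0" for e
  proof (rule ccontr)
    assume "\<not> ?thesis"
    then have "\<exists>\<^sub>F n in sequentially. \<exists>x\<in>G (\<sigma> n). e \<le> infdist x F"
      by (simp add: not_eventually not_less)
    then obtain s where s: "strict_mono (s::nat\<Rightarrow>nat)" "\<And>n. \<exists>x\<in>G (\<sigma> (s n)). e \<le> infdist x F"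
      using infinite_enumerate[of "{n. \<exists>x\<in>G (\<sigma> n). e \<le> infdist x F}"]
      by (auto simp: INFM_iff_infinite cofinite_eq_sequentially[symmetric])
    then obtain z where z: "\<And>n. z n \<in> G (\<sigma> (s n))" "\<And>n. e \<le> infdist (z n) F" by metis
    obtain x r where xr: "x \<in> F" "strict_mono (r::nat\<Rightarrow>nat)" "(z \<circ> r) \<longlonglongrightarrow> x"
      using GF[OF z(1) s(1)] by blast
    have "(\<lambda>n. infdist ((z \<circ> r) n) F) \<longlonglongrightarrow> infdist x F"
      using xr(3) by (rule tendsto_infdist)
    then have "e \<le> infdist x F" by (rule LIMSEQ_le_const) (use z(2) in auto)
    with xr(1) that show False by simp
  qed
  ultimately have "\<forall>\<^sub>F n in sequentially.
      (\<forall>x\<in>F. infdist x (G (\<sigma> n)) < e) \<and> (\<forall>x\<in>G (\<sigma> n). infdist x F < e)" if "e > 0" for e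
    using that eventually_conj by blast
  moreover have "F \<subseteq> K" by (auto simp: F_def)
  ultimately show thesis using that[of F \<sigma>] Fne closedF \<sigma>(1) by blast
qed

section \<open>Farthest distances, radii and centers\<close>

lemma far_dist_upper:
  assumes "bounded F" "a \<in> F"
  shows "norm (x - a) \<le> far_dist x F"
proof -
  obtain M where "\<And>y. y \<in> F \<Longrightarrow> norm y \<le> M" using assms(1) by (auto simp: bounded_iff)
  then have "norm (x - y) \<le> norm x + M" if "y \<in> F" for y
    using that norm_triangle_ineq4[of x y] by (meson add_left_mono order_trans)
  then have "bdd_above ((\<lambda>a. norm (x - a)) ` F)" by (rule bdd_aboveI2)
  then show ?thesis unfolding far_dist_def using assms(2) by (rule cSUP_upper2) simp
qed

text \<open>Upper bounds determine a real number, so this equivalence and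
  \<open>far_dist_upper\<close> stand in for the supremum in later arguments;
  \<open>rad_ge_iff\<close> does the same for the infimum.\<close>

lemma far_dist_le_iff:
  assumes "F \<noteq> {}" "bounded F"
  shows "far_dist x F \<le> M \<longleftrightarrow> (\<forall>a\<in>F. norm (x - a) \<le> M)"
proof
  assume "far_dist x F \<le> M"
  then show "\<forall>a\<in>F. norm (x - a) \<le> M"
    using far_dist_upper[OF assms(2)] order_trans by blast
next
  assume "\<forall>a\<in>F. norm (x - a) \<le> M"
  then show "far_dist x F \<le> M"
    unfolding far_dist_def using assms(1) by (auto intro!: cSUP_least)
qed

lemma far_dist_nonneg:
  assumes "F \<noteq> {}" "bounded F"
  shows "0 \<le> far_dist x F"
proof -
  obtain a where "a \<in> F" using assms(1) by blast
  then show ?thesis using far_dist_upper[OF assms(2), of a x] norm_ge_zero order_trans by blast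
qed

lemma far_dist_triangle:
  assumes "F \<noteq> {}" "bounded F"
  shows "far_dist x F \<le> far_dist y F + dist x y"
  unfolding far_dist_le_iff[OF assms]
proof
  fix a assume "a \<in> F"
  then have "norm (y - a) \<le> far_dist y F" using assms(2) by (rule far_dist_upper[rotated])
  then show "norm (x - a) \<le> far_dist y F + dist x y"
    using norm_triangle_ineq[of "x - y" "y - a"] by (simp add: dist_norm)
qed

lemma continuous_on_far_dist:
  assumes "F \<noteq> {}" "bounded F"
  shows "continuous_on S (\<lambda>x. far_dist x F)"
proof -
  have "dist (far_dist x F) (far_dist y F) \<le> dist x y" for x y
    using far_dist_triangle[OF assms, of x y] far_dist_triangle[OF assms, of y x]
    by (simp add: dist_real_def dist_commute)
  then show ?thesis unfolding continuous_on_iff by (meson le_less_trans)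
qed

lemma rad_ge_iff:
  assumes "F \<noteq> {}" "bounded F" "V \<noteq> {}"
  shows "M \<le> rad V F \<longleftrightarrow> (\<forall>v\<in>V. M \<le> far_dist v F)"
proof -
  have "bdd_below ((\<lambda>v. far_dist v F) ` V)"
    using far_dist_nonneg[OF assms(1,2)] by (rule bdd_belowI2)
  then show ?thesis unfolding rad_def using assms(3) by (intro le_cINF_iff)
qed

lemma rad_le_far_dist:
  assumes "F \<noteq> {}" "bounded F" "v \<in> V"
  shows "rad V F \<le> far_dist v F"
proof -
  have "V \<noteq> {}" using assms(3) by blast
  from rad_ge_iff[OF assms(1,2) this, of "rad V F"] assms(3) show ?thesis by blast
qed

lemma rad_nonneg:
  assumes "F \<noteq> {}" "bounded F" "V \<noteq> {}"
  shows "0 \<le> rad V F"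
  using rad_ge_iff[OF assms] far_dist_nonneg[OF assms(1,2)] by blast

lemma centers_eq_near_centers:
  assumes "F \<noteq> {}" "bounded F"
  shows "centers V F = near_centers V F 0"
  using rad_le_far_dist[OF assms] by (auto simp: centers_def near_centers_def intro: antisym)

lemma near_centers_mono: "\<delta> \<le> \<delta>' \<Longrightarrow> near_centers V F \<delta> \<subseteq> near_centers V F \<delta>'"
  by (auto simp: near_centers_def)

text \<open>The continuous function \<open>far_dist\<close> attains its minimum on a compact part of
  \<open>Y\<close> so large that outside it the value at \<open>y0\<close> is never
  undercut.\<close>

lemma centers_nonempty:
  fixes Y :: "'a::real_normed_vector set"
  assumes compact: "\<And>r. compact (cball (0::'a) r)" and "closed Y" "Y \<noteq> {}" "F \<noteq> {}" "bounded F"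
  shows "centers Y F \<noteq> {}"
proof -
  obtain y0 g where y0: "y0 \<in> Y" and g: "g \<in> F" using assms by blast
  define R where "R = far_dist y0 F"
  \<comment> \<open>For g in \<open>F\<close>, the norm of v is at most
    \<open>norm y0 + R + far_dist v F\<close>. Beyond \<open>norm y0 + 2 * R\<close> this forces
    \<open>far_dist v F\<close> above \<open>R\<close>.\<close>
  define K where "K = Y \<inter> cball 0 (norm y0 + 2 * R)"
  have "R \<ge> 0" unfolding R_def using assms by (intro far_dist_nonneg)
  have "compact K" unfolding K_def using assms by (simp add: closed_Int_compact)
  moreover have "y0 \<in> K" using y0 \<open>R \<ge> 0\<close> by (simp add: K_def)
  ultimately obtain c where c: "c \<in> K" "\<And>v. v \<in> K \<Longrightarrow> far_dist c F \<le> far_dist v F"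
    using continuous_attains_inf[of K "\<lambda>v. far_dist v F"] continuous_on_far_dist[OF assms(4,5)]
    by blast
  have "far_dist c F \<le> far_dist v F" if "v \<in> Y" for v
  proof (cases "v \<in> K")
    case False
    then have "norm v > norm y0 + 2 * R" using that by (auto simp: K_def)
    moreover have "norm (y0 - g) \<le> R"
      unfolding R_def using assms g by (intro far_dist_upper)
    moreover have "norm v \<le> norm y0 + norm (y0 - g) + norm (v - g)"
      using norm_triangle_ineq[of y0 "v - y0"] norm_triangle_ineq4[of "v - g" "y0 - g"] by simp
    moreover have "norm (v - g) \<le> far_dist v F"
      using assms g by (intro far_dist_upper)
    ultimately have "R \<le> far_dist v F" by linarith
    then show ?thesis using c(2)[OF \<open>y0 \<in> K\<close>] by (simp add: R_def)
  qed (use c in blast)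
  then have "far_dist c F \<le> rad Y F"
    using rad_ge_iff[of F Y] assms by blast
  moreover have "c \<in> Y" using c(1) by (simp add: K_def)
  ultimately have "c \<in> near_centers Y F 0" by (simp add: near_centers_def)
  then show ?thesis using centers_eq_near_centers assms by blast
qed

section \<open>Enlargements and the Hausdorff distance\<close>

text \<open>Replaces the Minkowski sum by a distance condition. The vector of the unit ball is (x -
  a) divided by r; for r = 0 it is 0, as \<open>inverse 0 = 0\<close>.\<close>

lemma mem_enlarge:
  assumes "r \<ge> 0"
  shows "x \<in> enlarge A r \<longleftrightarrow> (\<exists>a\<in>A. norm (x - a) \<le> r)"
proof
  assume "x \<in> enlarge A r"
  then obtain a u where "a \<in> A" "norm u \<le> 1" "x = a + r *\<^sub>R u"
    by (auto simp: enlarge_def set_plus_def)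
  then show "\<exists>a\<in>A. norm (x - a) \<le> r"
    using assms by (intro bexI[of _ a]) (auto simp: mult_left_le)
next
  assume "\<exists>a\<in>A. norm (x - a) \<le> r"
  then obtain a where a: "a \<in> A" "norm (x - a) \<le> r" by blast
  have "x = a + r *\<^sub>R ((x - a) /\<^sub>R r)" using a(2) by (cases "r = 0") auto
  moreover have "(x - a) /\<^sub>R r \<in> cball 0 1"
    using assms a(2) by (cases "r = 0") (auto simp: divide_inverse_commute[symmetric] simp del: scaleR_diff_right)
  ultimately show "x \<in> enlarge A r"
    unfolding enlarge_def set_plus_def using a(1) by blast
qed

lemma enlarge_mono: "0 \<le> r \<Longrightarrow> r \<le> s \<Longrightarrow> enlarge A r \<subseteq> enlarge A s"
proof
  fix x assume "0 \<le> r" "r \<le> s" "x \<in> enlarge A r"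
  then obtain a where "a \<in> A" "norm (x - a) \<le> r" by (auto simp: mem_enlarge)
  with \<open>r \<le> s\<close> have "\<exists>a\<in>A. norm (x - a) \<le> s" by (intro bexI[of _ a]) simp_all
  then show "x \<in> enlarge A s" using \<open>0 \<le> r\<close> \<open>r \<le> s\<close> by (simp add: mem_enlarge)
qed

lemma bounded_subset_enlarge:
  assumes "bounded A" "bounded B" "B \<noteq> {}"
  obtains r where "r > 0" "A \<subseteq> enlarge B r"
proof -
  obtain b where b: "b \<in> B" using assms(3) by blast
  obtain r where "r > 0" "\<And>a. a \<in> A \<Longrightarrow> norm (a - b) \<le> r"
    using bounded_translation_minus[OF assms(1), of b] by (auto simp: bounded_pos)
  then have "A \<subseteq> enlarge B r" using b mem_enlarge[of r _ B] by (auto intro: less_imp_le)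
  with \<open>r > 0\<close> show thesis by (rule that)
qed

lemma hausdorff_dist_lessD:
  assumes "A \<in> CB" "B \<in> CB" "hausdorff_dist A B < \<delta>"
  shows "A \<subseteq> enlarge B \<delta>" "B \<subseteq> enlarge A \<delta>"
proof -
  let ?R = "{r. r > 0 \<and> A \<subseteq> enlarge B r \<and> B \<subseteq> enlarge A r}"
  \<comment> \<open>One radius has to serve both inclusions, hence the maximum. It shows that
    \<open>?R\<close> is nonempty, which is required before \<open>Inf\<close> yields a smaller
    element.\<close>
  obtain r s where "r > 0" "A \<subseteq> enlarge B r" "s > 0" "B \<subseteq> enlarge A s"
    using bounded_subset_enlarge assms(1,2) unfolding CB_def mem_Collect_eq by metis
  then have "max r s \<in> ?R"
    using enlarge_mono[of r "max r s" B] enlarge_mono[of s "max r s" A] by auto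
  then obtain t where "t \<in> ?R" "t < \<delta>"
    using cInf_lessD[of ?R \<delta>] assms(3) unfolding hausdorff_dist_def by blast
  then show "A \<subseteq> enlarge B \<delta>" "B \<subseteq> enlarge A \<delta>"
    using enlarge_mono[of t \<delta>] by (auto dest!: less_imp_le)
qed

lemma hausdorff_dist_le:
  assumes "r > 0" "A \<subseteq> enlarge B r" "B \<subseteq> enlarge A r"
  shows "hausdorff_dist A B \<le> r"
  unfolding hausdorff_dist_def using assms by (intro cInf_lower bdd_belowI[of _ 0]) auto

lemma far_dist_enlarge:
  assumes "F \<noteq> {}" "bounded F" "G \<noteq> {}" "bounded G" "r \<ge> 0" "G \<subseteq> enlarge F r"
  shows "far_dist x G \<le> far_dist x F + r"
  unfolding far_dist_le_iff[OF assms(3,4)]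
proof
  fix a assume "a \<in> G"
  then obtain b where b: "b \<in> F" "norm (a - b) \<le> r"
    using assms(6) mem_enlarge[OF assms(5)] by blast
  then show "norm (x - a) \<le> far_dist x F + r"
    using far_dist_upper[OF assms(2) b(1), of x] norm_triangle_ineq4[of "x - b" "a - b"] by simp
qed

text \<open>Used with \<open>F\<close> and \<open>G\<close> in both roles, this makes the radius
  1-Lipschitz for the Hausdorff distance.\<close>

lemma rad_enlarge:
  assumes "F \<noteq> {}" "bounded F" "G \<noteq> {}" "bounded G" "r \<ge> 0" "G \<subseteq> enlarge F r" "V \<noteq> {}"
  shows "rad V G \<le> rad V F + r"
proof -
  have "rad V G - r \<le> far_dist v F" if "v \<in> V" for v
    using far_dist_enlarge[OF assms(1-6), of v] rad_le_far_dist[OF assms(3,4) that] by simp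
  then show ?thesis using rad_ge_iff[OF assms(1,2,7), of "rad V G - r"] by simp
qed

section \<open>Invariance under similarities\<close>

lemma far_dist_similarity:
  assumes "F \<noteq> {}" "bounded F" "c > 0"
  shows "far_dist (t + c *\<^sub>R x) ((\<lambda>x. t + c *\<^sub>R x) ` F) = c * far_dist x F" (is "far_dist ?y ?F = _")
proof -
  have ne: "?F \<noteq> {}" and bdd: "bounded ?F"
    using assms by (auto intro: bounded_scaling bounded_translation[of "(*\<^sub>R) c ` F", simplified image_image])
  have "norm (?y - (t + c *\<^sub>R a)) = c * norm (x - a)" for a
    using \<open>c > 0\<close> by (simp flip: scaleR_diff_right)
  \<comment> \<open>Equality is obtained by showing that both sides have the same upper bounds
    \<open>M\<close>; \<open>rad_similarity\<close> argues likewise with lower bounds.\<close>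
  then have "far_dist ?y ?F \<le> M \<longleftrightarrow> c * far_dist x F \<le> M" for M
    using far_dist_le_iff[OF assms(1,2), of x "M / c"] \<open>c > 0\<close>
    by (simp add: far_dist_le_iff[OF ne bdd] field_simps)
  then show ?thesis by (meson order_antisym order_refl)
qed

lemma similarity_image_subspace:
  assumes "subspace Y" "t \<in> Y" "c > 0"
  shows "(\<lambda>x. t + c *\<^sub>R x) ` Y = Y"
proof (intro equalityI subsetI)
  fix y assume "y \<in> Y"
  then have "(y - t) /\<^sub>R c \<in> Y"
    using assms by (simp add: subspace_diff subspace_scale)
  then show "y \<in> (\<lambda>x. t + c *\<^sub>R x) ` Y"
    by (rule rev_image_eqI) (use \<open>c > 0\<close> in simp)
qed (use assms in \<open>auto intro: subspace_add subspace_scale\<close>)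

lemma CB_similarity:
  assumes "F \<in> CB" "c > 0"
  shows "(\<lambda>x. t + c *\<^sub>R x) ` F \<in> CB"
proof -
  have "(\<lambda>x. t + c *\<^sub>R x) ` F = (+) t ` (*\<^sub>R) c ` F" by (simp add: image_image)
  then show ?thesis using assms
    by (simp add: CB_def closed_scaling closed_translation bounded_scaling bounded_translation)
qed

context
  fixes Y F :: "'a::real_normed_vector set" and c :: real and t :: 'a
  assumes Y: "subspace Y" "t \<in> Y" and c: "c > 0" and F: "F \<in> CB"
begin

lemma rad_similarity: "rad Y ((\<lambda>x. t + c *\<^sub>R x) ` F) = c * rad Y F"
proof -
  let ?f = "\<lambda>x. t + c *\<^sub>R x"
  have ne: "F \<noteq> {}" "bounded F" "?f ` F \<noteq> {}" "bounded (?f ` F)" "Y \<noteq> {}"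
    using F CB_similarity[OF F c] Y by (auto simp: CB_def)
  have "M \<le> rad Y (?f ` F) \<longleftrightarrow> M \<le> c * rad Y F" for M
  proof -
    have "M \<le> rad Y (?f ` F) \<longleftrightarrow> (\<forall>v\<in>?f ` Y. M \<le> far_dist v (?f ` F))"
      using rad_ge_iff[OF ne(3-5)] similarity_image_subspace[OF Y c] by simp
    also have "\<dots> \<longleftrightarrow> (\<forall>v\<in>Y. M / c \<le> far_dist v F)"
      using c by (simp add: far_dist_similarity[OF ne(1,2)] field_simps)
    also have "\<dots> \<longleftrightarrow> M \<le> c * rad Y F"
      using rad_ge_iff[OF ne(1,2,5), of "M / c"] c by (simp add: field_simps)
    finally show ?thesis .
  qed
  then show ?thesis by (meson order_antisym order_refl)
qed

lemma near_centers_similarity: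
  "near_centers Y ((\<lambda>x. t + c *\<^sub>R x) ` F) (c * \<delta>) = (\<lambda>x. t + c *\<^sub>R x) ` near_centers Y F \<delta>"
proof -
  let ?f = "\<lambda>x. t + c *\<^sub>R x"
  have "near_centers Y (?f ` F) (c * \<delta>) = {v \<in> ?f ` Y. far_dist v (?f ` F) \<le> c * (rad Y F + \<delta>)}"
    by (simp add: near_centers_def rad_similarity similarity_image_subspace[OF Y c] distrib_left)
  also have "\<dots> = ?f ` {v \<in> Y. far_dist (?f v) (?f ` F) \<le> c * (rad Y F + \<delta>)}" by blast
  also have "\<dots> = ?f ` near_centers Y F \<delta>"
    using F c by (simp add: CB_def far_dist_similarity near_centers_def)
  finally show ?thesis .
qed

lemma centers_similarity:
  "centers Y ((\<lambda>x. t + c *\<^sub>R x) ` F) = (\<lambda>x. t + c *\<^sub>R x) ` centers Y F"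
  using near_centers_similarity[of 0] F CB_similarity[OF F c, of t]
  by (simp add: CB_def centers_eq_near_centers)

text \<open>The inclusion in both properties survives a similarity once tolerance and error are
  multiplied by \<open>c\<close>. The theorem uses it for translations (\<open>c = 1\<close>) and
  for rescalings (\<open>t = 0\<close>).\<close>

lemma near_centers_subset_similarity:
  assumes "\<epsilon> > 0"
  shows "near_centers Y ((\<lambda>x. t + c *\<^sub>R x) ` F) (c * \<delta>)
           \<subseteq> enlarge (centers Y ((\<lambda>x. t + c *\<^sub>R x) ` F)) (c * \<epsilon>)
         \<longleftrightarrow> near_centers Y F \<delta> \<subseteq> enlarge (centers Y F) \<epsilon>"
proof -
  have "norm (t + c *\<^sub>R x - (t + c *\<^sub>R y)) = c * norm (x - y)" for x y
    using c by (simp flip: scaleR_diff_right)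
  then show ?thesis
    using assms c
    by (simp add: near_centers_similarity centers_similarity subset_iff mem_enlarge ball_simps
      flip: Ball_def)
qed

end

section \<open>Compactness in one direction, rescaling in the other\<close>

theorem corollary3p16:
  fixes Y :: "'a::banach set"
  assumes finite_dim: "\<exists>B::'a set. finite B \<and> span B = UNIV"
    and "subspace Y"
  shows "property_lP2 Y CB \<longleftrightarrow> property_P2 Y {F \<in> CB. rad Y F = 1}"
proof -
  obtain B :: "'a set" where B: "finite B" "span B = UNIV" using finite_dim by blast
  have cpt: "compact (cball (0::'a) r)" for r using compact_cball_span[OF B(1), of r] B(2) by simp
  have Yne: "Y \<noteq> {}" and "0 \<in> Y" using \<open>subspace Y\<close> subspace_0 by auto
  \<comment> \<open>This settles the existence clause of both properties, so each direction only has
    to find \<delta>.\<close>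
  have centers_ne: "centers Y G \<noteq> {}" if "G \<in> CB" for G
    using centers_nonempty[OF cpt closed_finite_dim_subspace[OF B \<open>subspace Y\<close>] Yne] that
    by (simp add: CB_def)
  show ?thesis
  proof
    assume lP2: "property_lP2 Y CB"
    have "\<exists>\<delta>>0. \<forall>G\<in>{F \<in> CB. rad Y F = 1}. near_centers Y G \<delta> \<subseteq> enlarge (centers Y G) \<epsilon>"
      if "\<epsilon> > 0" for \<epsilon>
    proof (rule ccontr)
      assume "\<not> ?thesis"
      then have "\<exists>G\<in>CB. rad Y G = 1 \<and> \<not> near_centers Y G \<delta> \<subseteq> enlarge (centers Y G) \<epsilon>" if "\<delta> > 0" for \<delta>
        using that by blast
      then have "\<forall>n. \<exists>G\<in>CB. rad Y G = 1 \<and>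
          \<not> near_centers Y G (inverse (real (Suc n))) \<subseteq> enlarge (centers Y G) \<epsilon>"
        by simp
      then obtain G where G: "\<And>n. G n \<in> CB" "\<And>n. rad Y (G n) = 1"
        "\<And>n. \<not> near_centers Y (G n) (inverse (real (Suc n))) \<subseteq> enlarge (centers Y (G n)) \<epsilon>"
        by metis
      have "\<forall>n. \<exists>c. c \<in> centers Y (G n)" using centers_ne G(1) by blast
      then obtain c where c: "\<And>n. c n \<in> centers Y (G n)" by metis
      have cY: "- c n \<in> Y" for n
        using c \<open>subspace Y\<close> by (auto simp: centers_def subspace_neg)
      \<comment> \<open>The chosen center moves to 0, and as the radius is 1 the set moves into the
        unit ball. The factor 1 is written out to fit the similarity lemmas.\<close>
      define G' where "G' n = (\<lambda>x. - c n + 1 *\<^sub>R x) ` G n" for n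
      have G'_CB: "G' n \<in> CB" for n unfolding G'_def using G(1) by (rule CB_similarity) simp
      have "G' n \<subseteq> cball 0 1" for n
      proof
        fix x assume "x \<in> G' n"
        then obtain g where g: "g \<in> G n" "x = - c n + g" by (auto simp: G'_def)
        have "norm (c n - g) \<le> far_dist (c n) (G n)"
          using G(1)[of n] g(1) by (intro far_dist_upper) (auto simp: CB_def)
        also have "\<dots> = 1" using c[of n] G(2) by (simp add: centers_def)
        finally show "x \<in> cball 0 1" using g(2) by (simp add: norm_minus_commute)
      qed
      moreover have G'_ne: "G' n \<noteq> {}" for n using G'_CB[of n] by (simp add: CB_def)
      ultimately obtain F \<sigma> where F: "F \<subseteq> cball 0 1" "F \<noteq> {}" "closed F" and \<sigma>: "strict_mono (\<sigma>::nat\<Rightarrow>nat)"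
        and lim: "\<And>e. e > 0 \<Longrightarrow> \<forall>\<^sub>F n in sequentially.
          (\<forall>x\<in>F. infdist x (G' (\<sigma> n)) < e) \<and> (\<forall>x\<in>G' (\<sigma> n). infdist x F < e)"
        using Blaschke_selection[OF cpt[of 1], of G'] by blast
      have F_CB: "F \<in> CB" using F bounded_subset[OF bounded_cball] by (auto simp: CB_def)
      then obtain \<delta> where \<delta>: "\<delta> > 0" "\<And>G. G \<in> CB \<Longrightarrow> hausdorff_dist F G < \<delta> \<Longrightarrow>
          near_centers Y G \<delta> \<subseteq> enlarge (centers Y G) \<epsilon>"
        using lP2 \<open>\<epsilon> > 0\<close> unfolding property_lP2_def by metis
      \<comment> \<open>The index n has two tasks: \<sigma> n \<ge> n \<ge> n0 brings the tolerance
        of the counterexample below \<delta>, and the translated set must be close to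
        \<open>F\<close>.\<close>
      obtain n0 where n0: "inverse (real (Suc n0)) < \<delta>" using reals_Archimedean \<delta>(1) by blast
      have "\<forall>\<^sub>F n in sequentially. n \<ge> n0 \<and>
          (\<forall>x\<in>F. infdist x (G' (\<sigma> n)) < \<delta>/2) \<and> (\<forall>x\<in>G' (\<sigma> n). infdist x F < \<delta>/2)"
        using lim[of "\<delta>/2"] \<delta>(1) by (intro eventually_conj[OF eventually_ge_at_top]) simp
      then obtain n where n: "n \<ge> n0" "\<And>x. x \<in> F \<Longrightarrow> infdist x (G' (\<sigma> n)) < \<delta>/2"
        "\<And>x. x \<in> G' (\<sigma> n) \<Longrightarrow> infdist x F < \<delta>/2"
        unfolding eventually_sequentially by blast
      \<comment> \<open>A strict bound on the infimum yields an actual point. Working with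
        \<delta>/2 leaves the Hausdorff distance strictly below \<delta>.\<close>
      have close: "\<exists>a\<in>A. norm (x - a) \<le> \<delta>/2" if "infdist x A < \<delta>/2" "A \<noteq> {}" for x and A :: "'a set"
        using that by (auto simp: infdist_notempty cINF_less_iff simp flip: dist_norm
          simp del: less_divide_eq_numeral1 le_divide_eq_numeral1 intro: less_imp_le)
      have "hausdorff_dist F (G' (\<sigma> n)) \<le> \<delta>/2"
        using \<delta>(1) n(2,3) close G'_ne F(2) by (intro hausdorff_dist_le subsetI) (auto simp: mem_enlarge)
      then have "near_centers Y (G' (\<sigma> n)) \<delta> \<subseteq> enlarge (centers Y (G' (\<sigma> n))) \<epsilon>"
        using \<delta> G'_CB by simp
      then have "near_centers Y (G (\<sigma> n)) \<delta> \<subseteq> enlarge (centers Y (G (\<sigma> n))) \<epsilon>"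
        using near_centers_subset_similarity[OF \<open>subspace Y\<close> cY zero_less_one G(1) \<open>\<epsilon> > 0\<close>, of "\<sigma> n" "\<sigma> n" \<delta>]
        by (simp add: G'_def)
      moreover have "inverse (real (Suc (\<sigma> n))) \<le> inverse (real (Suc n0))"
        using n(1) seq_suble[OF \<sigma>, of n] by (intro le_imp_inverse_le) auto
      then have "near_centers Y (G (\<sigma> n)) (inverse (real (Suc (\<sigma> n)))) \<subseteq> near_centers Y (G (\<sigma> n)) \<delta>"
        using n0 by (intro near_centers_mono) linarith
      ultimately show False using G(3)[of "\<sigma> n"] by (meson order_trans)
    qed
    then show "property_P2 Y {F \<in> CB. rad Y F = 1}"
      using centers_ne by (simp add: property_P2_def)
  next
    assume P2: "property_P2 Y {F \<in> CB. rad Y F = 1}"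
    have "\<exists>\<delta>>0. \<forall>G\<in>CB. hausdorff_dist F G < \<delta> \<longrightarrow> near_centers Y G \<delta> \<subseteq> enlarge (centers Y G) \<epsilon>"
      if "\<epsilon> > 0" and F: "F \<in> CB" for \<epsilon> F
    proof -
      have F': "F \<noteq> {}" "bounded F" using F by (auto simp: CB_def)
      have rad_close: "rad Y G \<le> rad Y F + \<delta>" "rad Y F \<le> rad Y G + \<delta>"
        if "G \<in> CB" "hausdorff_dist F G < \<delta>" "\<delta> > 0" for G \<delta>
        using hausdorff_dist_lessD[OF F that(1,2)] that F' Yne
        by (auto simp: CB_def intro!: rad_enlarge)
      define R where "R = rad Y F"
      have "R \<ge> 0" unfolding R_def using F' Yne by (rule rad_nonneg)
      show ?thesis
      proof (cases "R = 0")
        case True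
        \<comment> \<open>The radius of \<open>G\<close> is at most \<epsilon>/3, so any point g of
          \<open>G\<close> is within 2\<epsilon>/3 of each near-center and within \<epsilon>/3 of
          each center.\<close>
        have "near_centers Y G (\<epsilon>/3) \<subseteq> enlarge (centers Y G) \<epsilon>"
          if G: "G \<in> CB" "hausdorff_dist F G < \<epsilon>/3" for G
        proof
          fix v assume v: "v \<in> near_centers Y G (\<epsilon>/3)"
          have G': "G \<noteq> {}" "bounded G" using G by (auto simp: CB_def)
          obtain c g where c: "c \<in> centers Y G" and g: "g \<in> G" using centers_ne G G' by blast
          have "rad Y G \<le> \<epsilon>/3" using rad_close(1)[OF G] True \<open>\<epsilon> > 0\<close> by (simp add: R_def)
          then have "far_dist v G \<le> 2 * (\<epsilon>/3)" "far_dist c G \<le> \<epsilon>/3"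
            using v c by (auto simp: near_centers_def centers_def)
          then have "norm (v - g) \<le> 2 * (\<epsilon>/3)" "norm (c - g) \<le> \<epsilon>/3"
            using far_dist_upper[OF G'(2) g] order_trans by blast+
          then have "norm (v - c) \<le> \<epsilon>" using norm_triangle_ineq4[of "v - g" "c - g"] by simp
          with c show "v \<in> enlarge (centers Y G) \<epsilon>" using \<open>\<epsilon> > 0\<close> by (auto simp: mem_enlarge)
        qed
        then show ?thesis using \<open>\<epsilon> > 0\<close> by (intro exI[of _ "\<epsilon>/3"]) simp
      next
        case False
        then have "R > 0" using \<open>R \<ge> 0\<close> by simp
        \<comment> \<open>The radius s of a set near \<open>F\<close> will be at most 2R, so scaling
          the error \<eta> back by s gives at most \<epsilon>.\<close>
        define \<eta> where "\<eta> = \<epsilon> / (2 * R)"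
        have "\<eta> > 0" using \<open>R > 0\<close> \<open>\<epsilon> > 0\<close> by (simp add: \<eta>_def)
        then obtain \<delta>' where \<delta>': "\<delta>' > 0"
          "\<And>G. G \<in> CB \<Longrightarrow> rad Y G = 1 \<Longrightarrow> near_centers Y G \<delta>' \<subseteq> enlarge (centers Y G) \<eta>"
          using P2 unfolding property_P2_def by blast
        \<comment> \<open>The bound R/2 keeps s between R/2 and 2R; the other bound then gives
          \<delta> \<le> s\<delta>'.\<close>
        define \<delta> where "\<delta> = min (R/2) (\<delta>' * (R/2))"
        have "\<delta> > 0" using \<open>R > 0\<close> \<delta>'(1) by (simp add: \<delta>_def)
        have "near_centers Y G \<delta> \<subseteq> enlarge (centers Y G) \<epsilon>"
          if G: "G \<in> CB" "hausdorff_dist F G < \<delta>" for G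
        proof -
          define s where "s = rad Y G"
          have s: "R/2 \<le> s" "s \<le> 2 * R"
            using rad_close[OF G \<open>\<delta> > 0\<close>] \<open>R > 0\<close> by (auto simp: s_def R_def[symmetric] \<delta>_def)
          then have "s > 0" using \<open>R > 0\<close> by simp
          define H where "H = (\<lambda>x. 0 + inverse s *\<^sub>R x) ` G"
          have "H \<in> CB" unfolding H_def using G(1) \<open>s > 0\<close> by (intro CB_similarity) auto
          moreover have "rad Y H = 1"
            unfolding H_def using rad_similarity[OF \<open>subspace Y\<close> \<open>0 \<in> Y\<close> _ G(1), of "inverse s"] \<open>s > 0\<close>
            by (simp add: s_def)
          ultimately have "near_centers Y H \<delta>' \<subseteq> enlarge (centers Y H) \<eta>" by (rule \<delta>'(2))
          \<comment> \<open>Rewrites the tolerance and error of the similarity lemma, taken with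
            \<open>c = inverse s\<close>, to \<delta>' and \<eta> for \<open>H\<close>, so that the
            inclusion is carried back to \<open>G\<close>.\<close>
          moreover have "inverse s * (s * x) = x" for x using \<open>s > 0\<close> by simp
          ultimately have "near_centers Y G (s * \<delta>') \<subseteq> enlarge (centers Y G) (s * \<eta>)"
            unfolding H_def
            using near_centers_subset_similarity[OF \<open>subspace Y\<close> \<open>0 \<in> Y\<close> _ G(1),
                of "inverse s" "s * \<eta>" "s * \<delta>'"] \<open>s > 0\<close> \<open>\<eta> > 0\<close> by (simp only:) simp
          moreover have "\<delta> \<le> s * \<delta>'"
            using mult_left_mono[OF s(1), of \<delta>'] \<delta>'(1)
            by (simp add: \<delta>_def mult.commute min.coboundedI2)
          moreover have "s * \<eta> \<le> \<epsilon>"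
            using mult_right_mono[OF s(2), of \<eta>] \<open>\<eta> > 0\<close> \<open>R > 0\<close> by (simp add: \<eta>_def)
          ultimately show ?thesis
            using near_centers_mono[of \<delta> "s * \<delta>'" Y G] enlarge_mono[of "s * \<eta>" \<epsilon> "centers Y G"]
              \<open>s > 0\<close> \<open>\<eta> > 0\<close> by (meson mult_pos_pos less_imp_le order_trans)
        qed
        then show ?thesis using \<open>\<delta> > 0\<close> by blast
      qed
    qed
    then show "property_lP2 Y CB"
      using centers_ne by (simp add: property_lP2_def)
  qed
qed

end
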